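(* Consider a Bell inequality $\mathscr{B}$: $I^{bell}\le B$ and the associated communication game $\mathbb{G}_{\mathscr{B}}$ (both defined in the context). Let a state $\rho^{AB}$ and $d$-outcome measurements $\{\Pi^a(x)\}_a$ of Alice and $\{Q^b(y)\}_b$ of Bob satisfy assumptions AI and AII: (AI) $\rho^{AB}$ is a density operator on $\mathbb{C}^D\otimes\mathbb{C}^d$ for some integer $D\ge d$ (Alice holding $\mathbb{C}^D$ and Bob $\mathbb{C}^d$), and the resulting correlations violate $\mathscr{B}$, i.e. $I^{bell}>B$; (AII) the state and measurements achieve the maximal quantum violation of $\mathscr{B}$, and the local results of each of Alice's measurements are uniformly random: $\mathrm{Tr}[(\Pi^a(x)\otimes\mathbf 1)\rho^{AB}]=1/d$ for all $x$ and all $a\in\{0,\dots,d-1\}$. Then there exists a prepare-transmit-measure protocol for $\mathbb{G}_{\mathscr{B}}$ (with a transmitted $d$-dimensional quantum system) whose average payoff satisfies $I^{qc}_{\mathbb{G}_{\mathscr{B}}}=I^{cc}_{\mathbb{G}_{\mathscr{B}}}$, where $I^{cc}_{\mathbb{G}_{\mathscr{B}}}$ is the average payoff of the entanglement-assisted linear strategy using the given state and measurements.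
   Context: **Bell inequality $\mathscr{B}$.** Fix integers $d\ge 2$, $m_A,m_B\ge 1$, $N\ge 1$, $K\ge 0$. Let $x\in\{0,\dots,m_A-1\}$, $y\in\{0,\dots,m_B-1\}$ and let $p(x,y)$ be a probability distribution on such pairs. For all $x,y$ and $i\in\{1,\dots,N\}$ let $F^i_{xy}:\{0,\dots,K\}\to\{0,\dots,d-1\}$ be functions such that, for each fixed $(x,y)$, the values $F^i_{xy}(k)$ for distinct pairs $(i,k)$ are distinct. Let $c^{i,k}_{xy}$ be real numbers. For conditional distributions $P(a,b|x,y)$ with $a,b\in\{0,\dots,d-1\}$ set $$I^{bell}=\sum_{x,y}p(x,y)\sum_{k=0}^K\sum_{i=1}^N c^{i,k}_{xy}\,P_{xy}\big(a+b=F^i_{xy}(k)\bmod d\big).$$ The classical bound $B$ is the maximum of $I^{bell}$ over local realistic distributions, equivalently over deterministic assignments $a=a(x)$, $b=b(y)$. **Quantum correlations.** A density operator $\rho^{AB}$ on $H_A\otimes H_B$ with, for each $x$, a projective measurement $\{\Pi^{a}(x)\}_{a=0}^{d-1}$ on $H_A$ and, for each $y$, a projective measurement $\{Q^{b}(y)\}_{b=0}^{d-1}$ on $H_B$ (orthogonal projectors, possibly zero, summing to the identity) yields $P(a,b|x,y)=\mathrm{Tr}[(\Pi^a(x)\otimes Q^b(y))\rho^{AB}]$. The maximal quantum violation is the supremum of $I^{bell}$ over all such states and measurements (over all complex separable Hilbert spaces $H_A,H_B$). **Game $\mathbb{G}_{\mathscr{B}}$.** Alice receives $x_0\in\{0,\dots,d-1\}$,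 uniformly distributed and independent of $(x,y)$, and $x$; Bob receives $y$; $(x,y)$ is distributed according to $p(x,y)$. Bob outputs a guess $G\in\{0,\dots,d-1\}$. If $G=f_{i,k}(x_0,x,y):=x_0+F^i_{xy}(k)\bmod d$, they earn the payoff $c^{i,k}_{xy}$. The average payoff is $$\frac1d\sum_{x_0,x,y}p(x,y)\sum_{k=0}^K\sum_{i=1}^N c^{i,k}_{xy}\,P\big(G=f_{i,k}(x_0,x,y)\,\big|\,x_0,x,y\big).$$ **Entanglement-assisted linear strategy ($I^{cc}_{\mathbb{G}_{\mathscr{B}}}$).** Alice performs the measurement labelled $x$ on her part of $\rho^{AB}$, obtains outcome $a$ and sends the classical message $m=x_0+a\bmod d$; Bob performs the measurement labelled $y$, obtains outcome $b$ and outputs $G=m+b\bmod d$. Its average payoff is denoted $I^{cc}_{\mathbb{G}_{\mathscr{B}}}$. **Prepare-transmit-measure protocol ($I^{qc}_{\mathbb{G}_{\mathscr{B}}}$).** Alice prepares, depending on $(x_0,x)$, a density operator $\rho_{x_0x}$ on $\mathbb{C}^d$ and sends the system to Bob, who performs a projective measurement on $\mathbb{C}^d$ with outcomes in $\{0,\dots,d-1\}$ depending on $y$ and outputs his outcome $b_y$ as the guess $G$. Its average payoff is $$I^{qc}_{\mathbb{G}_{\mathscr{B}}}=\frac1d\sum_{x_0=0}^{d-1}\sum_{x,y}p(x,y)\sum_{i=1}^N\sum_{k=0}^K c^{i,k}_{xy}\,P\big(b_y=f_{i,k}(x_0,x,y)\,\big|\,\rho_{x_0x},y\big).$$ *)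

theory Defs
  imports "HOL-Probability.Probability"
begin

section \<open>Operators on separable Hilbert spaces\<close>

text \<open>
  Every complex separable Hilbert space is isometrically isomorphic to \<open>l2 I\<close> for some set \<open>I\<close> of
  natural numbers, with \<open>\<complex>\<^sup>n\<close> being \<open>l2 {..<n}\<close>, and the Hilbert space tensor product of \<open>l2 I\<close> and
  \<open>l2 J\<close> is \<open>l2 (I \<times> J)\<close>.  Vectors vanish outside the index set.  Operators are functions of which
  only the restriction to \<open>l2 I\<close> matters.
\<close>

type_synonym 'i operator = "('i \<Rightarrow> complex) \<Rightarrow> ('i \<Rightarrow> complex)"

definition l2 :: "'i set \<Rightarrow> ('i \<Rightarrow> complex) set" where
  "l2 I = {\<psi>. (\<forall>i. i \<notin> I \<longrightarrow> \<psi> i = 0) \<and> (\<lambda>i. (cmod (\<psi> i))\<^sup>2) summable_on I}"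

definition l2_inner :: "'i set \<Rightarrow> ('i \<Rightarrow> complex) \<Rightarrow> ('i \<Rightarrow> complex) \<Rightarrow> complex" where
  "l2_inner I \<phi> \<psi> = (\<Sum>\<^sub>\<infinity>i\<in>I. cnj (\<phi> i) * \<psi> i)"

definition l2_norm :: "'i set \<Rightarrow> ('i \<Rightarrow> complex) \<Rightarrow> real" where
  "l2_norm I \<psi> = sqrt (\<Sum>\<^sub>\<infinity>i\<in>I. (cmod (\<psi> i))\<^sup>2)"

definition ket :: "'i \<Rightarrow> 'i \<Rightarrow> complex" where
  "ket i = (\<lambda>j. if j = i then 1 else 0)"

definition bounded_operator :: "'i set \<Rightarrow> 'i operator \<Rightarrow> bool" where
  "bounded_operator I A \<longleftrightarrow>
     (\<forall>\<psi>\<in>l2 I. A \<psi> \<in> l2 I) \<and>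
     (\<forall>\<phi>\<in>l2 I. \<forall>\<psi>\<in>l2 I. A (\<lambda>i. \<phi> i + \<psi> i) = (\<lambda>i. A \<phi> i + A \<psi> i)) \<and>
     (\<forall>z. \<forall>\<psi>\<in>l2 I. A (\<lambda>i. z * \<psi> i) = (\<lambda>i. z * A \<psi> i)) \<and>
     (\<exists>C. \<forall>\<psi>\<in>l2 I. l2_norm I (A \<psi>) \<le> C * l2_norm I \<psi>)"

definition op_trace :: "'i set \<Rightarrow> 'i operator \<Rightarrow> complex" where
  "op_trace I A = (\<Sum>\<^sub>\<infinity>i\<in>I. l2_inner I (ket i) (A (ket i)))"

definition orth_projector :: "'i set \<Rightarrow> 'i operator \<Rightarrow> bool" where
  "orth_projector I P \<longleftrightarrow>
     bounded_operator I P \<and>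
     (\<forall>\<psi>\<in>l2 I. P (P \<psi>) = P \<psi>) \<and>
     (\<forall>\<phi>\<in>l2 I. \<forall>\<psi>\<in>l2 I. l2_inner I \<phi> (P \<psi>) = l2_inner I (P \<phi>) \<psi>)"

definition projective_measurement :: "nat \<Rightarrow> 'i set \<Rightarrow> (nat \<Rightarrow> 'i operator) \<Rightarrow> bool" where
  "projective_measurement d I M \<longleftrightarrow>
     (\<forall>a<d. orth_projector I (M a)) \<and> (\<forall>\<psi>\<in>l2 I. (\<lambda>i. \<Sum>a<d. M a \<psi> i) = \<psi>)"

text \<open>
  A positive operator on a complex Hilbert space is self-adjoint.  An infinite sum that does not
  converge has value \<open>0\<close>, so the trace condition includes convergence, and a positive operator whose
  diagonal is summable in one orthonormal basis is trace class.
\<close>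

definition density_operator :: "'i set \<Rightarrow> 'i operator \<Rightarrow> bool" where
  "density_operator I \<rho> \<longleftrightarrow>
     bounded_operator I \<rho> \<and>
     (\<forall>\<psi>\<in>l2 I. Im (l2_inner I \<psi> (\<rho> \<psi>)) = 0 \<and> 0 \<le> Re (l2_inner I \<psi> (\<rho> \<psi>))) \<and>
     op_trace I \<rho> = 1"

text \<open>
  For bounded \<open>A\<close> and \<open>B\<close> this is the bounded operator on \<open>l2 (I \<times> J)\<close> that maps
  \<open>\<lambda>(i, j). u i * v j\<close> to \<open>\<lambda>(i, j). A u i * B v j\<close>: apply \<open>B\<close> to the second coordinate, then \<open>A\<close>
  to the first.
\<close>

definition tensor_op :: "'i operator \<Rightarrow> 'j operator \<Rightarrow> ('i \<times> 'j) operator" where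
  "tensor_op A B = (\<lambda>\<psi> (i, j). A (\<lambda>i'. B (\<lambda>j'. \<psi> (i', j')) j) i)"


section \<open>Bell inequalities\<close>

text \<open>\<open>shiftF x y i k\<close> is \<open>F\<^sup>i\<^sub>x\<^sub>y(k)\<close> and \<open>coef x y i k\<close> is \<open>c\<^sup>i\<^sup>,\<^sup>k\<^sub>x\<^sub>y\<close>.\<close>

record bell =
  outs :: nat  (* d *)
  setsA :: nat  (* m_A *)
  setsB :: nat  (* m_B *)
  numF :: nat  (* N *)
  topK :: nat  (* K *)
  input_prob :: "nat \<Rightarrow> nat \<Rightarrow> real"  (* p(x,y) *)
  shiftF :: "nat \<Rightarrow> nat \<Rightarrow> nat \<Rightarrow> nat \<Rightarrow> nat"
  coef :: "nat \<Rightarrow> nat \<Rightarrow> nat \<Rightarrow> nat \<Rightarrow> real"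

definition bell_inequality :: "bell \<Rightarrow> bool" where
  "bell_inequality \<B> \<longleftrightarrow>
     2 \<le> outs \<B> \<and> 1 \<le> setsA \<B> \<and> 1 \<le> setsB \<B> \<and> 1 \<le> numF \<B> \<and>
     (\<forall>x<setsA \<B>. \<forall>y<setsB \<B>. 0 \<le> input_prob \<B> x y) \<and>
     (\<Sum>x<setsA \<B>. \<Sum>y<setsB \<B>. input_prob \<B> x y) = 1 \<and>
     (\<forall>x<setsA \<B>. \<forall>y<setsB \<B>.
        (\<forall>i\<in>{1..numF \<B>}. \<forall>k\<in>{0..topK \<B>}. shiftF \<B> x y i k < outs \<B>) \<and>
        inj_on (\<lambda>(i, k). shiftF \<B> x y i k) ({1..numF \<B>} \<times> {0..topK \<B>}))"

text \<open>A correlation \<open>P\<close> is applied as \<open>P a b x y\<close>, standing for \<open>P(a,b|x,y)\<close>.\<close>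

type_synonym correlation = "nat \<Rightarrow> nat \<Rightarrow> nat \<Rightarrow> nat \<Rightarrow> real"

definition prob_sum_eq :: "nat \<Rightarrow> correlation \<Rightarrow> nat \<Rightarrow> nat \<Rightarrow> nat \<Rightarrow> real" where
  "prob_sum_eq d P x y s = (\<Sum>a<d. \<Sum>b<d. if (a + b) mod d = s mod d then P a b x y else 0)"

definition bell_value :: "bell \<Rightarrow> correlation \<Rightarrow> real" where
  "bell_value \<B> P =
     (\<Sum>x<setsA \<B>. \<Sum>y<setsB \<B>. input_prob \<B> x y *
        (\<Sum>k=0..topK \<B>. \<Sum>i=1..numF \<B>.
           coef \<B> x y i k * prob_sum_eq (outs \<B>) P x y (shiftF \<B> x y i k)))"

text \<open>
  A local realistic model: a hidden variable \<open>l\<close> distributed according to \<open>M\<close>, and local response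
  functions \<open>pA x a l\<close> and \<open>pB y b l\<close>.  Taking \<open>M\<close> on the reals loses nothing: already the models
  with a deterministic assignment attain the classical bound, see
  \<open>classical_bound_eq_Max_deterministic\<close> below.
\<close>

definition local_realistic :: "bell \<Rightarrow> correlation \<Rightarrow> bool" where
  "local_realistic \<B> P \<longleftrightarrow>
     (\<exists>(M :: real measure) pA pB. prob_space M \<and>
        (\<forall>x<setsA \<B>. (\<forall>a<outs \<B>. pA x a \<in> borel_measurable M \<and> (\<forall>l\<in>space M. 0 \<le> pA x a l)) \<and>
                     (\<forall>l\<in>space M. (\<Sum>a<outs \<B>. pA x a l) = 1)) \<and>
        (\<forall>y<setsB \<B>. (\<forall>b<outs \<B>. pB y b \<in> borel_measurable M \<and> (\<forall>l\<in>space M. 0 \<le> pB y b l)) \<and>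
                     (\<forall>l\<in>space M. (\<Sum>b<outs \<B>. pB y b l) = 1)) \<and>
        (\<forall>x<setsA \<B>. \<forall>y<setsB \<B>. \<forall>a<outs \<B>. \<forall>b<outs \<B>.
           P a b x y = (\<integral>l. pA x a l * pB y b l \<partial>M)))"

definition classical_bound :: "bell \<Rightarrow> real" where
  "classical_bound \<B> = Sup {bell_value \<B> P | P. local_realistic \<B> P}"

definition deterministic :: "(nat \<Rightarrow> nat) \<Rightarrow> (nat \<Rightarrow> nat) \<Rightarrow> correlation" where
  "deterministic \<alpha> \<beta> = (\<lambda>a b x y. if a = \<alpha> x \<and> b = \<beta> y then 1 else 0)"

lemma bell_value_expand:
  "bell_value \<B> P = (\<Sum>x<setsA \<B>. \<Sum>y<setsB \<B>. \<Sum>a<outs \<B>. \<Sum>b<outs \<B>.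
     (input_prob \<B> x y * (\<Sum>k=0..topK \<B>. \<Sum>i=1..numF \<B>. coef \<B> x y i k *
        (if (a + b) mod outs \<B> = shiftF \<B> x y i k mod outs \<B> then 1 else 0))) * P a b x y)"
proof -
  have "(\<Sum>k=0..topK \<B>. \<Sum>i=1..numF \<B>.
           coef \<B> x y i k * prob_sum_eq (outs \<B>) P x y (shiftF \<B> x y i k)) =
        (\<Sum>a<outs \<B>. \<Sum>b<outs \<B>. (\<Sum>k=0..topK \<B>. \<Sum>i=1..numF \<B>. coef \<B> x y i k *
        (if (a + b) mod outs \<B> = shiftF \<B> x y i k mod outs \<B> then 1 else 0)) * P a b x y)"
    (is "?L = ?R") for x y
  proof -
    let ?f = "\<lambda>a b k i. coef \<B> x y i k *
        (if (a + b) mod outs \<B> = shiftF \<B> x y i k mod outs \<B> then 1 else 0) * P a b x y"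
    have "?L = (\<Sum>k=0..topK \<B>. \<Sum>i=1..numF \<B>. \<Sum>a<outs \<B>. \<Sum>b<outs \<B>. ?f a b k i)"
      unfolding prob_sum_eq_def sum_distrib_left by (intro sum.cong refl) auto
    also have "\<dots> = (\<Sum>k=0..topK \<B>. \<Sum>a<outs \<B>. \<Sum>i=1..numF \<B>. \<Sum>b<outs \<B>. ?f a b k i)"
      by (intro sum.cong refl sum.swap)
    also have "\<dots> = (\<Sum>k=0..topK \<B>. \<Sum>a<outs \<B>. \<Sum>b<outs \<B>. \<Sum>i=1..numF \<B>. ?f a b k i)"
      by (intro sum.cong refl sum.swap)
    also have "\<dots> = (\<Sum>a<outs \<B>. \<Sum>k=0..topK \<B>. \<Sum>b<outs \<B>. \<Sum>i=1..numF \<B>. ?f a b k i)"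
      by (rule sum.swap)
    also have "\<dots> = (\<Sum>a<outs \<B>. \<Sum>b<outs \<B>. \<Sum>k=0..topK \<B>. \<Sum>i=1..numF \<B>. ?f a b k i)"
      by (intro sum.cong refl sum.swap)
    also have "\<dots> = ?R"
      by (simp add: sum_distrib_right)
    finally show ?thesis .
  qed
  note inner = this
  have distrib: "z * (\<Sum>a<outs \<B>. \<Sum>b<outs \<B>. G a b * H a b) =
    (\<Sum>a<outs \<B>. \<Sum>b<outs \<B>. (z * G a b) * H a b)" for z :: real and G H
    by (simp add: sum_distrib_left mult.assoc)
  show ?thesis
    unfolding bell_value_def by (simp only: inner distrib)
qed

lemma product_le_deterministic:
  fixes w :: "nat \<Rightarrow> nat \<Rightarrow> nat \<Rightarrow> nat \<Rightarrow> real"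
  assumes "0 < d"
    and u: "\<And>x a. x < m \<Longrightarrow> a < d \<Longrightarrow> 0 \<le> u x a" "\<And>x. x < m \<Longrightarrow> (\<Sum>a<d. u x a) = 1"
    and v: "\<And>y b. y < n \<Longrightarrow> b < d \<Longrightarrow> 0 \<le> v y b" "\<And>y. y < n \<Longrightarrow> (\<Sum>b<d. v y b) = 1"
  shows "\<exists>\<alpha>\<in>{..<m} \<rightarrow>\<^sub>E {..<d}. \<exists>\<beta>\<in>{..<n} \<rightarrow>\<^sub>E {..<d}.
    (\<Sum>x<m. \<Sum>y<n. \<Sum>a<d. \<Sum>b<d. w x y a b * (u x a * v y b))
      \<le> (\<Sum>x<m. \<Sum>y<n. \<Sum>a<d. \<Sum>b<d. w x y a b * deterministic \<alpha> \<beta> a b x y)"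
proof -
  have convex: "\<exists>\<alpha>\<in>{..<m'} \<rightarrow>\<^sub>E {..<d}. (\<Sum>x<m'. \<Sum>a<d. u' x a * g x a) \<le> (\<Sum>x<m'. g x (\<alpha> x))"
    if u': "\<And>x a. x < m' \<Longrightarrow> a < d \<Longrightarrow> 0 \<le> u' x a" "\<And>x. x < m' \<Longrightarrow> (\<Sum>a<d. u' x a) = 1"
    for m' :: nat and u' g :: "nat \<Rightarrow> nat \<Rightarrow> real"
  proof -
    have "\<exists>a<d. (\<Sum>a<d. u' x a * g x a) \<le> g x a" if x: "x < m'" for x
    proof -
      have ne: "g x ` {..<d} \<noteq> {}" using \<open>0 < d\<close> by auto
      have "Max (g x ` {..<d}) \<in> g x ` {..<d}" by (rule Max_in) (use ne in auto)
      then obtain a where a: "a < d" "Max (g x ` {..<d}) = g x a" by auto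
      have "(\<Sum>a'<d. u' x a' * g x a') \<le> (\<Sum>a'<d. u' x a' * g x a)"
        by (intro sum_mono mult_left_mono) (use a(2)[symmetric] u' x in auto)
      also have "\<dots> = g x a"
        using u'(2)[OF x] by (simp flip: sum_distrib_right)
      finally show ?thesis using a by blast
    qed
    then obtain \<alpha> where \<alpha>: "\<And>x. x < m' \<Longrightarrow> \<alpha> x < d \<and> (\<Sum>a<d. u' x a * g x a) \<le> g x (\<alpha> x)"
      by metis
    show ?thesis
      by (rule bexI[where x = "restrict \<alpha> {..<m'}"]) (auto intro!: sum_mono simp: \<alpha>)
  qed
  let ?g = "\<lambda>x a. \<Sum>y<n. \<Sum>b<d. v y b * w x y a b"
  obtain \<alpha> where \<alpha>: "\<alpha> \<in> {..<m} \<rightarrow>\<^sub>E {..<d}"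
    and le1: "(\<Sum>x<m. \<Sum>a<d. u x a * ?g x a) \<le> (\<Sum>x<m. ?g x (\<alpha> x))"
    using convex[of m u ?g] u by auto
  let ?h = "\<lambda>y b. \<Sum>x<m. w x y (\<alpha> x) b"
  obtain \<beta> where \<beta>: "\<beta> \<in> {..<n} \<rightarrow>\<^sub>E {..<d}"
    and le2: "(\<Sum>y<n. \<Sum>b<d. v y b * ?h y b) \<le> (\<Sum>y<n. ?h y (\<beta> y))"
    using convex[of n v ?h] v by auto
  have "(\<Sum>x<m. \<Sum>y<n. \<Sum>a<d. \<Sum>b<d. w x y a b * (u x a * v y b)) =
        (\<Sum>x<m. \<Sum>a<d. \<Sum>y<n. \<Sum>b<d. w x y a b * (u x a * v y b))"
    by (intro sum.cong refl sum.swap)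
  also have "\<dots> = (\<Sum>x<m. \<Sum>a<d. u x a * ?g x a)"
    by (simp add: sum_distrib_left mult_ac)
  also note le1
  also have "(\<Sum>x<m. ?g x (\<alpha> x)) = (\<Sum>y<n. \<Sum>x<m. \<Sum>b<d. v y b * w x y (\<alpha> x) b)"
    by (rule sum.swap)
  also have "\<dots> = (\<Sum>y<n. \<Sum>b<d. \<Sum>x<m. v y b * w x y (\<alpha> x) b)"
    by (intro sum.cong refl sum.swap)
  also have "\<dots> = (\<Sum>y<n. \<Sum>b<d. v y b * ?h y b)"
    by (simp add: sum_distrib_left)
  also note le2
  also have "(\<Sum>y<n. ?h y (\<beta> y)) = (\<Sum>x<m. \<Sum>y<n. w x y (\<alpha> x) (\<beta> y))"
    by (rule sum.swap)
  also have "\<dots> = (\<Sum>x<m. \<Sum>y<n. \<Sum>a<d. \<Sum>b<d. w x y a b * deterministic \<alpha> \<beta> a b x y)"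
  proof (intro sum.cong refl)
    fix x y assume "x \<in> {..<m}" "y \<in> {..<n}"
    then have ab: "\<alpha> x < d" "\<beta> y < d" using \<alpha> \<beta> by auto
    have "(\<Sum>a<d. \<Sum>b<d. w x y a b * deterministic \<alpha> \<beta> a b x y) =
          (\<Sum>a<d. \<Sum>b<d. if b = \<beta> y then (if a = \<alpha> x then w x y a b else 0) else 0)"
      by (intro sum.cong refl) (auto simp: deterministic_def)
    also have "\<dots> = w x y (\<alpha> x) (\<beta> y)"
      using ab by simp
    finally show "w x y (\<alpha> x) (\<beta> y) = (\<Sum>a<d. \<Sum>b<d. w x y a b * deterministic \<alpha> \<beta> a b x y)" ..
  qed
  finally show ?thesis using \<alpha> \<beta> by blast
qed

lemma deterministic_local_realistic:
  assumes "\<alpha> \<in> {..<setsA \<B>} \<rightarrow>\<^sub>E {..<outs \<B>}" "\<beta> \<in> {..<setsB \<B>} \<rightarrow>\<^sub>E {..<outs \<B>}"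
  shows "local_realistic \<B> (deterministic \<alpha> \<beta>)"
proof -
  let ?M = "return (count_space UNIV) (0::real)"
  let ?pA = "\<lambda>x a (l::real). if a = \<alpha> x then 1 else 0 :: real"
  let ?pB = "\<lambda>y b (l::real). if b = \<beta> y then 1 else 0 :: real"
  interpret prob_space ?M by (rule prob_space_return) simp
  show ?thesis
    unfolding local_realistic_def
  proof (rule exI[where x = ?M], rule exI[where x = ?pA], rule exI[where x = ?pB],
      intro conjI allI impI ballI)
    show "prob_space ?M" by (rule prob_space_axioms)
    fix x y a b :: nat
    show "deterministic \<alpha> \<beta> a b x y = (\<integral>l. ?pA x a l * ?pB y b l \<partial>?M)"
      using prob_space by (auto simp: deterministic_def)
  qed (use assms in \<open>auto simp: PiE_iff\<close>)
qed

lemma classical_bound_eq_Max_deterministic: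
  assumes "bell_inequality \<B>"
  shows "classical_bound \<B> =
    Max ((\<lambda>(\<alpha>, \<beta>). bell_value \<B> (deterministic \<alpha> \<beta>)) `
      (({..<setsA \<B>} \<rightarrow>\<^sub>E {..<outs \<B>}) \<times> ({..<setsB \<B>} \<rightarrow>\<^sub>E {..<outs \<B>})))"
    (is "_ = Max ?D")
proof -
  let ?d = "outs \<B>" and ?m = "setsA \<B>" and ?n = "setsB \<B>"
  have d: "0 < ?d" using assms by (simp add: bell_inequality_def)
  have fin: "finite ?D" by (intro finite_imageI finite_cartesian_product finite_PiE) auto
  have ne: "?D \<noteq> {}"
  proof -
    have "(\<lambda>x\<in>{..<k}. 0) \<in> {..<k} \<rightarrow>\<^sub>E {..<?d}" for k :: nat
      using d by auto
    then show ?thesis by blast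
  qed
  define w where "w x y a b = input_prob \<B> x y * (\<Sum>k=0..topK \<B>. \<Sum>i=1..numF \<B>. coef \<B> x y i k *
        (if (a + b) mod ?d = shiftF \<B> x y i k mod ?d then 1 else 0))" for x y a b
  have bv: "bell_value \<B> P = (\<Sum>x<?m. \<Sum>y<?n. \<Sum>a<?d. \<Sum>b<?d. w x y a b * P a b x y)" for P
    unfolding w_def by (rule bell_value_expand)
  have le: "bell_value \<B> P \<le> Max ?D" if "local_realistic \<B> P" for P
  proof -
    obtain M :: "real measure" and pA pB where model: "prob_space M"
      "\<forall>x<?m. (\<forall>a<?d. pA x a \<in> borel_measurable M \<and> (\<forall>l\<in>space M. 0 \<le> pA x a l)) \<and>
              (\<forall>l\<in>space M. (\<Sum>a<?d. pA x a l) = 1)"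
      "\<forall>y<?n. (\<forall>b<?d. pB y b \<in> borel_measurable M \<and> (\<forall>l\<in>space M. 0 \<le> pB y b l)) \<and>
              (\<forall>l\<in>space M. (\<Sum>b<?d. pB y b l) = 1)"
      "\<forall>x<?m. \<forall>y<?n. \<forall>a<?d. \<forall>b<?d. P a b x y = (\<integral>l. pA x a l * pB y b l \<partial>M)"
      using \<open>local_realistic \<B> P\<close> unfolding local_realistic_def by (elim exE conjE)
    have A: "pA x a \<in> borel_measurable M" if "x < ?m" "a < ?d" for x a
      using model(2) that by blast
    have A0: "0 \<le> pA x a l" if "x < ?m" "a < ?d" "l \<in> space M" for x a l
      using model(2) that by blast
    have A_sum: "(\<Sum>a<?d. pA x a l) = 1" if "x < ?m" "l \<in> space M" for x l
      using model(2) that by blast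
    have B: "pB y b \<in> borel_measurable M" if "y < ?n" "b < ?d" for y b
      using model(3) that by blast
    have B0: "0 \<le> pB y b l" if "y < ?n" "b < ?d" "l \<in> space M" for y b l
      using model(3) that by blast
    have B_sum: "(\<Sum>b<?d. pB y b l) = 1" if "y < ?n" "l \<in> space M" for y l
      using model(3) that by blast
    interpret prob_space M by (rule model(1))
    have A1: "pA x a l \<le> 1" if "x < ?m" "a < ?d" "l \<in> space M" for x a l
      using A_sum[OF that(1,3)] member_le_sum[of a "{..<?d}" "\<lambda>a. pA x a l"] A0 that by auto
    have B1: "pB y b l \<le> 1" if "y < ?n" "b < ?d" "l \<in> space M" for y b l
      using B_sum[OF that(1,3)] member_le_sum[of b "{..<?d}" "\<lambda>b. pB y b l"] B0 that by auto
    have int: "integrable M (\<lambda>l. pA x a l * pB y b l)"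
      if "x < ?m" "y < ?n" "a < ?d" "b < ?d" for x y a b
    proof (rule integrable_const_bound[where B = 1])
      show "AE l in M. norm (pA x a l * pB y b l) \<le> 1"
        using A0 A1 B0 B1 that by (auto intro!: mult_le_one simp: abs_mult)
      show "(\<lambda>l. pA x a l * pB y b l) \<in> borel_measurable M"
        using A B that by (intro borel_measurable_times) auto
    qed
    let ?W = "\<lambda>l. \<Sum>x<?m. \<Sum>y<?n. \<Sum>a<?d. \<Sum>b<?d. w x y a b * (pA x a l * pB y b l)"
    have W: "has_bochner_integral M ?W
        (\<Sum>x<?m. \<Sum>y<?n. \<Sum>a<?d. \<Sum>b<?d. w x y a b * (\<integral>l. pA x a l * pB y b l \<partial>M))"
      by (intro has_bochner_integral_sum has_bochner_integral_mult_right
          has_bochner_integral_integrable int) auto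
    then have intW: "integrable M ?W" by (rule integrable.intros)
    have "bell_value \<B> P = (\<Sum>x<?m. \<Sum>y<?n. \<Sum>a<?d. \<Sum>b<?d. w x y a b * (\<integral>l. pA x a l * pB y b l \<partial>M))"
      unfolding bv using model(4) by (intro sum.cong refl) auto
    also have "\<dots> = (\<integral>l. ?W l \<partial>M)"
      using W by (rule has_bochner_integral_integral_eq[symmetric])
    also have "\<dots> \<le> (\<integral>l. Max ?D \<partial>M)"
    proof (rule integral_mono[OF intW])
      fix l assume l: "l \<in> space M"
      have "\<exists>\<alpha>\<in>{..<?m} \<rightarrow>\<^sub>E {..<?d}. \<exists>\<beta>\<in>{..<?n} \<rightarrow>\<^sub>E {..<?d}.
          ?W l \<le> bell_value \<B> (deterministic \<alpha> \<beta>)"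
        unfolding bv
        by (rule product_le_deterministic[OF d]) (fact A0[OF _ _ l] A_sum[OF _ l] B0[OF _ _ l] B_sum[OF _ l])+
      then obtain \<alpha> \<beta> where ab: "\<alpha> \<in> {..<?m} \<rightarrow>\<^sub>E {..<?d}" "\<beta> \<in> {..<?n} \<rightarrow>\<^sub>E {..<?d}"
        and "?W l \<le> bell_value \<B> (deterministic \<alpha> \<beta>)"
        by blast
      note this(3)
      also have "\<dots> \<le> Max ?D"
        by (rule Max_ge[OF fin], rule image_eqI[where x = "(\<alpha>, \<beta>)"]) (use ab in auto)
      finally show "?W l \<le> Max ?D" .
    qed simp
    also have "\<dots> = Max ?D" by (simp add: prob_space)
    finally show ?thesis .
  qed
  have "Max ?D \<in> {bell_value \<B> P | P. local_realistic \<B> P}"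
  proof -
    obtain \<alpha> \<beta> where "Max ?D = bell_value \<B> (deterministic \<alpha> \<beta>)"
      "\<alpha> \<in> {..<?m} \<rightarrow>\<^sub>E {..<?d}" "\<beta> \<in> {..<?n} \<rightarrow>\<^sub>E {..<?d}"
      using Max_in[OF fin ne] by (elim imageE SigmaE) (simp only: prod.case)
    then show ?thesis using deterministic_local_realistic[of \<alpha> \<B> \<beta>] by (intro CollectI exI conjI)
  qed
  then show ?thesis
    unfolding classical_bound_def by (rule cSup_eq_maximum) (elim CollectE exE conjE, simp only: le)
qed

definition quantum_model ::
  "bell \<Rightarrow> nat set \<Rightarrow> nat set \<Rightarrow> (nat \<times> nat) operator \<Rightarrow>
   (nat \<Rightarrow> nat \<Rightarrow> nat operator) \<Rightarrow> (nat \<Rightarrow> nat \<Rightarrow> nat operator) \<Rightarrow> bool" where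
  "quantum_model \<B> I J \<rho> PA QB \<longleftrightarrow>
     density_operator (I \<times> J) \<rho> \<and>
     (\<forall>x<setsA \<B>. projective_measurement (outs \<B>) I (PA x)) \<and>
     (\<forall>y<setsB \<B>. projective_measurement (outs \<B>) J (QB y))"

text \<open>
  For models in the sense of \<open>quantum_model\<close> the trace is real, so \<open>Re\<close> only converts the type.
\<close>

definition quantum_corr ::
  "nat set \<Rightarrow> nat set \<Rightarrow> (nat \<times> nat) operator \<Rightarrow>
   (nat \<Rightarrow> nat \<Rightarrow> nat operator) \<Rightarrow> (nat \<Rightarrow> nat \<Rightarrow> nat operator) \<Rightarrow> correlation" where
  "quantum_corr I J \<rho> PA QB = (\<lambda>a b x y. Re (op_trace (I \<times> J) (tensor_op (PA x a) (QB y b) \<circ> \<rho>)))"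

text \<open>
  \<open>I\<close> and \<open>J\<close> range over all sets of natural numbers, hence over all separable Hilbert spaces of the
  two parties up to isometry.
\<close>

definition max_quantum_value :: "bell \<Rightarrow> ereal" where
  "max_quantum_value \<B> =
     Sup {ereal (bell_value \<B> (quantum_corr I J \<rho> PA QB)) | I J \<rho> PA QB. quantum_model \<B> I J \<rho> PA QB}"


section \<open>The communication game\<close>

text \<open>A strategy is given by the guessing probabilities \<open>R x0 x y g = P(G = g|x0, x, y)\<close>.\<close>

definition average_payoff :: "bell \<Rightarrow> (nat \<Rightarrow> nat \<Rightarrow> nat \<Rightarrow> nat \<Rightarrow> real) \<Rightarrow> real" where
  "average_payoff \<B> R =
     1 / real (outs \<B>) *
     (\<Sum>x0<outs \<B>. \<Sum>x<setsA \<B>. \<Sum>y<setsB \<B>. input_prob \<B> x y *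
        (\<Sum>k=0..topK \<B>. \<Sum>i=1..numF \<B>.
           coef \<B> x y i k * R x0 x y ((x0 + shiftF \<B> x y i k) mod outs \<B>)))"

definition linear_strategy :: "nat \<Rightarrow> correlation \<Rightarrow> nat \<Rightarrow> nat \<Rightarrow> nat \<Rightarrow> nat \<Rightarrow> real" where
  "linear_strategy d P = (\<lambda>x0 x y g.
     \<Sum>a<d. \<Sum>b<d. let m = (x0 + a) mod d in if (m + b) mod d = g then P a b x y else 0)"

definition cc_payoff :: "bell \<Rightarrow> correlation \<Rightarrow> real" where
  "cc_payoff \<B> P = average_payoff \<B> (linear_strategy (outs \<B>) P)"

definition ptm_protocol ::
  "bell \<Rightarrow> (nat \<Rightarrow> nat \<Rightarrow> nat operator) \<Rightarrow> (nat \<Rightarrow> nat \<Rightarrow> nat operator) \<Rightarrow> bool" where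
  "ptm_protocol \<B> \<sigma> M \<longleftrightarrow>
     (\<forall>x0<outs \<B>. \<forall>x<setsA \<B>. density_operator {..<outs \<B>} (\<sigma> x0 x)) \<and>
     (\<forall>y<setsB \<B>. projective_measurement (outs \<B>) {..<outs \<B>} (M y))"

definition qc_payoff ::
  "bell \<Rightarrow> (nat \<Rightarrow> nat \<Rightarrow> nat operator) \<Rightarrow> (nat \<Rightarrow> nat \<Rightarrow> nat operator) \<Rightarrow> real" where
  "qc_payoff \<B> \<sigma> M =
     average_payoff \<B> (\<lambda>x0 x y g. Re (op_trace {..<outs \<B>} (M y g \<circ> \<sigma> x0 x)))"

end

theory Submission
  imports Defs
begin

text \<open>
  If Alice measures \<open>x\<close> on her half of the state and obtains \<open>a\<close>, Bob's half collapses to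
  \<open>d Tr\<^sub>A[(\<Pi>\<^sup>a(x) \<otimes> 1) \<rho>]\<close>, a density operator on \<open>\<complex>\<^sup>d\<close> because the outcome \<open>a\<close> has probability
  \<open>1/d\<close>.  For the input \<open>(x\<^sub>0, x)\<close> Alice sends this operator for the outcome \<open>a = -x\<^sub>0 mod d\<close>, and
  Bob performs his Bell measurement \<open>y\<close> and guesses its outcome \<open>b\<close>.  Then \<open>b = x\<^sub>0 + F mod d\<close> means
  \<open>a + b = F mod d\<close>, and averaging over \<open>x\<^sub>0\<close> reproduces the sum over \<open>a\<close>.
\<close>

section \<open>Operators on finite-dimensional spaces\<close>

lemma l2_finite: "finite I \<Longrightarrow> l2 I = {\<psi>. \<forall>i. i \<notin> I \<longrightarrow> \<psi> i = 0}"
  by (auto simp: l2_def)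

lemma l2_inner_finite: "finite I \<Longrightarrow> l2_inner I \<phi> \<psi> = (\<Sum>i\<in>I. cnj (\<phi> i) * \<psi> i)"
  by (simp add: l2_inner_def)

lemma l2_norm_finite: "finite I \<Longrightarrow> l2_norm I \<psi> = L2_set (\<lambda>i. cmod (\<psi> i)) I"
  by (simp add: l2_norm_def L2_set_def)

lemma ket_in_l2: "finite I \<Longrightarrow> i \<in> I \<Longrightarrow> ket i \<in> l2 I"
  by (auto simp: l2_finite ket_def)

lemma l2_inner_ket: "finite I \<Longrightarrow> i \<in> I \<Longrightarrow> l2_inner I (ket i) \<psi> = \<psi> i"
proof -
  assume "finite I" "i \<in> I"
  moreover have "(\<Sum>j\<in>I. cnj (ket i j) * \<psi> j) = (\<Sum>j\<in>I. if j = i then \<psi> j else 0)"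
    by (rule sum.cong) (auto simp: ket_def)
  ultimately show ?thesis by (simp add: l2_inner_finite)
qed

lemma op_trace_finite: "finite I \<Longrightarrow> op_trace I A = (\<Sum>i\<in>I. A (ket i) i)"
  by (simp add: op_trace_def l2_inner_ket)

lemma bounded_operator_l2: "bounded_operator I A \<Longrightarrow> \<psi> \<in> l2 I \<Longrightarrow> A \<psi> \<in> l2 I"
  by (simp add: bounded_operator_def)

lemma bounded_operator_outside:
  "finite I \<Longrightarrow> bounded_operator I A \<Longrightarrow> \<psi> \<in> l2 I \<Longrightarrow> i \<notin> I \<Longrightarrow> A \<psi> i = 0"
  using bounded_operator_l2[of I A \<psi>] by (simp add: l2_finite)

lemma bounded_operator_id: "bounded_operator I id"
  by (auto simp: bounded_operator_def intro: exI[of _ 1])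

text \<open>Homogeneity with the scalar 0. It starts the induction of the next lemma and handles
  vanishing rows in \<open>tensor_op_matrix\<close>.\<close>

lemma bounded_operator_zero:
  assumes "finite I" "bounded_operator I A"
  shows "A (\<lambda>_. 0) = (\<lambda>_. 0)"
proof -
  have "(\<lambda>_. 0) \<in> l2 I" using assms(1) by (simp add: l2_finite)
  moreover have "\<forall>z. \<forall>\<psi>\<in>l2 I. A (\<lambda>i. z * \<psi> i) = (\<lambda>i. z * A \<psi> i)"
    using assms(2) by (simp add: bounded_operator_def)
  ultimately have "A (\<lambda>i. 0 * 0) = (\<lambda>i. 0 * A (\<lambda>_. 0) i)"
    by (elim allE[where x = 0] ballE[where x = "\<lambda>_. 0"]) simp_all
  then show ?thesis by simp
qed

text \<open>Expand \<open>\<psi>\<close> in the finite basis of kets and use linearity. This reduces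
  the later trace computations to matrix entries \<open>A (ket k) i\<close>.\<close>

lemma bounded_operator_matrix:
  assumes I: "finite I" and A: "bounded_operator I A" and \<psi>: "\<psi> \<in> l2 I"
  shows "A \<psi> i = (\<Sum>k\<in>I. A (ket k) i * \<psi> k)"
proof -
  have add: "A (\<lambda>i. \<phi> i + \<xi> i) = (\<lambda>i. A \<phi> i + A \<xi> i)" if "\<phi> \<in> l2 I" "\<xi> \<in> l2 I" for \<phi> \<xi>
    using A that by (simp add: bounded_operator_def)
  have scale: "A (\<lambda>i. z * \<phi> i) = (\<lambda>i. z * A \<phi> i)" if "\<phi> \<in> l2 I" for z \<phi>
    using A that by (simp add: bounded_operator_def)
  \<comment> \<open>Additivity is available only for vectors in \<open>l2 I\<close>, so the
    induction runs over subsets \<open>K\<close> of \<open>I\<close> and checks that each partial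
    sum stays in that space.\<close>
  have "A (\<lambda>i. \<Sum>k\<in>K. \<psi> k * ket k i) = (\<lambda>i. \<Sum>k\<in>K. A (ket k) i * \<psi> k)" if "K \<subseteq> I" for K
    using finite_subset[OF that I] that
  proof (induction K rule: finite_induct)
    case empty
    then show ?case using bounded_operator_zero[OF I A] by simp
  next
    case (insert k K)
    have k: "ket k \<in> l2 I" using insert by (intro ket_in_l2 I) auto
    then have "(\<lambda>i. \<psi> k * ket k i) \<in> l2 I" using I by (simp add: l2_finite)
    moreover have "(\<lambda>i. \<Sum>k\<in>K. \<psi> k * ket k i) \<in> l2 I"
      using I insert.prems by (auto simp: l2_finite ket_def intro!: sum.neutral)
    ultimately show ?case
      using insert add scale[OF k] by (simp add: mult.commute)
  qed
  from this[of I] have "A (\<lambda>i. \<Sum>k\<in>I. \<psi> k * ket k i) i = (\<Sum>k\<in>I. A (ket k) i * \<psi> k)"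
    by simp
  moreover have "(\<lambda>i. \<Sum>k\<in>I. \<psi> k * ket k i) = \<psi>"
  proof
    fix i
    have "(\<Sum>k\<in>I. \<psi> k * ket k i) = (\<Sum>k\<in>I. if i = k then \<psi> k else 0)"
      by (rule sum.cong) (auto simp: ket_def)
    then show "(\<Sum>k\<in>I. \<psi> k * ket k i) = \<psi> i"
      using I \<psi> by (simp add: l2_finite)
  qed
  ultimately show ?thesis by simp
qed

text \<open>The cutoff to 0 outside \<open>I\<close> keeps the image in \<open>l2 I\<close>.\<close>

definition matrix_op :: "'i set \<Rightarrow> ('i \<Rightarrow> 'i \<Rightarrow> complex) \<Rightarrow> 'i operator" where
  "matrix_op I S = (\<lambda>\<psi> i. if i \<in> I then \<Sum>k\<in>I. S i k * \<psi> k else 0)"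

lemma matrix_op_ket:
  assumes "finite I" "i \<in> I" "k \<in> I"
  shows "matrix_op I S (ket k) i = S i k"
proof -
  have "(\<Sum>l\<in>I. S i l * ket k l) = (\<Sum>l\<in>I. if l = k then S i l else 0)"
    by (rule sum.cong) (auto simp: ket_def)
  then show ?thesis using assms by (simp add: matrix_op_def)
qed

lemma bounded_operator_matrix_op:
  assumes I: "finite I"
  shows "bounded_operator I (matrix_op I S)"
  unfolding bounded_operator_def
proof (intro conjI ballI allI)
  \<comment> \<open>A crude bound suffices: the 2-norm is at most the 1-norm, and each
    \<open>cmod (\<psi> k)\<close> is at most the norm of \<open>\<psi>\<close>.\<close>
  let ?C = "\<Sum>i\<in>I. \<Sum>k\<in>I. cmod (S i k)"
  show "\<exists>C. \<forall>\<psi>\<in>l2 I. l2_norm I (matrix_op I S \<psi>) \<le> C * l2_norm I \<psi>"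
  proof (intro exI ballI)
    fix \<psi>
    have "l2_norm I (matrix_op I S \<psi>) \<le> (\<Sum>i\<in>I. cmod (matrix_op I S \<psi> i))"
      by (simp add: l2_norm_finite I L2_set_le_sum)
    also have "\<dots> \<le> (\<Sum>i\<in>I. \<Sum>k\<in>I. cmod (S i k) * l2_norm I \<psi>)"
    proof (rule sum_mono)
      fix i assume "i \<in> I"
      then have "cmod (matrix_op I S \<psi> i) \<le> (\<Sum>k\<in>I. cmod (S i k) * cmod (\<psi> k))"
        by (auto simp: matrix_op_def norm_mult intro!: order.trans[OF norm_sum])
      also have "\<dots> \<le> (\<Sum>k\<in>I. cmod (S i k) * l2_norm I \<psi>)"
        using I by (intro sum_mono mult_left_mono) (auto simp: l2_norm_finite intro!: member_le_L2_set)
      finally show "cmod (matrix_op I S \<psi> i) \<le> \<dots>" .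
    qed
    also have "\<dots> = ?C * l2_norm I \<psi>" by (simp add: sum_distrib_right)
    finally show "l2_norm I (matrix_op I S \<psi>) \<le> ?C * l2_norm I \<psi>" .
  qed
qed (use I in \<open>auto simp: l2_finite matrix_op_def algebra_simps sum.distrib sum_distrib_left\<close>)

lemma tensor_op_matrix:
  assumes I: "finite I" and J: "finite J"
    and A: "bounded_operator I A" and B: "bounded_operator J B" and \<psi>: "\<psi> \<in> l2 (I \<times> J)"
  shows "tensor_op A B \<psi> (i, j) = (\<Sum>k\<in>I. \<Sum>l\<in>J. A (ket k) i * B (ket l) j * \<psi> (k, l))"
proof -
  have row: "(\<lambda>l. \<psi> (k, l)) \<in> l2 J" for k
    using \<psi> I J by (simp add: l2_finite)
  \<comment> \<open>For \<open>k\<close> outside \<open>I\<close> the row of \<open>\<psi>\<close>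
    is the zero vector, which \<open>B\<close> maps to zero.\<close>
  have "(\<lambda>k. B (\<lambda>l. \<psi> (k, l)) j) \<in> l2 I"
    using \<psi> I J bounded_operator_zero[OF J B] by (simp add: l2_finite)
  then show ?thesis
    using bounded_operator_matrix[OF I A, of "\<lambda>k. B (\<lambda>l. \<psi> (k, l)) j" i]
      bounded_operator_matrix[OF J B row]
    by (simp add: tensor_op_def sum_distrib_left mult.assoc)
qed

section \<open>Steered states\<close>

text \<open>The matrix of \<open>Tr\<^sub>A[(A \<otimes> 1) \<rho>]\<close>.\<close>

definition steered_matrix ::
  "'i set \<Rightarrow> 'i operator \<Rightarrow> ('i \<times> 'j) operator \<Rightarrow> 'j \<Rightarrow> 'j \<Rightarrow> complex" where
  "steered_matrix I A \<rho> l j = (\<Sum>i\<in>I. \<Sum>k\<in>I. A (ket k) i * \<rho> (ket (i, j)) (k, l))"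

text \<open>The defining property of the partial trace: both sides expand into one fourfold sum of
  matrix entries, up to order. Bob's projectors as \<open>B\<close> give his outcome probabilities
  in the steered state, \<open>B = id\<close> its normalisation.\<close>

lemma op_trace_steered:
  assumes I: "finite I" and J: "finite J"
    and A: "bounded_operator I A" and B: "bounded_operator J B" and \<rho>: "bounded_operator (I \<times> J) \<rho>"
  shows "op_trace J (B \<circ> matrix_op J (\<lambda>l j. c * steered_matrix I A \<rho> l j)) =
    c * op_trace (I \<times> J) (tensor_op A B \<circ> \<rho>)"
proof -
  let ?S = "\<lambda>l j. c * steered_matrix I A \<rho> l j"
  let ?t = "\<lambda>i j k l. A (ket k) i * B (ket l) j * \<rho> (ket (i, j)) (k, l)"
  have "op_trace J (B \<circ> matrix_op J ?S) = (\<Sum>j\<in>J. \<Sum>l\<in>J. B (ket l) j * ?S l j)"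
    using bounded_operator_matrix[OF J B bounded_operator_l2[OF bounded_operator_matrix_op[OF J] ket_in_l2[OF J]]]
    by (simp add: op_trace_finite J matrix_op_ket)
  also have "\<dots> = c * (\<Sum>j\<in>J. \<Sum>l\<in>J. \<Sum>i\<in>I. \<Sum>k\<in>I. ?t i j k l)"
    by (simp add: steered_matrix_def sum_distrib_left mult_ac)
  also have "(\<Sum>j\<in>J. \<Sum>l\<in>J. \<Sum>i\<in>I. \<Sum>k\<in>I. ?t i j k l) = (\<Sum>j\<in>J. \<Sum>i\<in>I. \<Sum>l\<in>J. \<Sum>k\<in>I. ?t i j k l)"
    by (intro sum.cong refl sum.swap)
  also have "\<dots> = (\<Sum>i\<in>I. \<Sum>j\<in>J. \<Sum>l\<in>J. \<Sum>k\<in>I. ?t i j k l)"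
    by (rule sum.swap)
  also have "\<dots> = (\<Sum>i\<in>I. \<Sum>j\<in>J. \<Sum>k\<in>I. \<Sum>l\<in>J. ?t i j k l)"
    by (intro sum.cong refl sum.swap)
  also have "\<dots> = (\<Sum>i\<in>I. \<Sum>j\<in>J. (tensor_op A B \<circ> \<rho>) (ket (i, j)) (i, j))"
    using I J by (intro sum.cong refl)
      (simp add: tensor_op_matrix[OF I J A B bounded_operator_l2[OF \<rho>]] ket_in_l2)
  also have "\<dots> = op_trace (I \<times> J) (tensor_op A B \<circ> \<rho>)"
    using I J by (simp add: op_trace_finite sum.cartesian_product case_prod_unfold)
  finally show ?thesis .
qed

text \<open>Idempotence and self-adjointness together say that \<open>P\<close> is \<open>P\<close>
  times its adjoint; this is that factorisation in matrix entries.\<close>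

lemma orth_projector_entry:
  assumes I: "finite I" and P: "orth_projector I P" and "i \<in> I" "k \<in> I"
  shows "P (ket k) i = (\<Sum>l\<in>I. P (ket l) i * cnj (P (ket l) k))"
proof -
  have b: "bounded_operator I P" using P by (simp add: orth_projector_def)
  have adj: "P (ket k) l = cnj (P (ket l) k)" if "l \<in> I" for l
  proof -
    have "l2_inner I (ket l) (P (ket k)) = l2_inner I (P (ket l)) (ket k)"
      using P ket_in_l2[OF I] that \<open>k \<in> I\<close> by (simp add: orth_projector_def)
    moreover have "l2_inner I (P (ket l)) (ket k) = cnj (l2_inner I (ket k) (P (ket l)))"
      by (simp add: l2_inner_finite I mult.commute)
    ultimately show ?thesis using that \<open>k \<in> I\<close> I by (simp add: l2_inner_ket)
  qed
  have "P (ket k) i = P (P (ket k)) i"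
    using P ket_in_l2[OF I \<open>k \<in> I\<close>] by (simp add: orth_projector_def)
  also have "\<dots> = (\<Sum>l\<in>I. P (ket l) i * P (ket k) l)"
    by (rule bounded_operator_matrix[OF I b bounded_operator_l2[OF b ket_in_l2[OF I \<open>k \<in> I\<close>]]])
  also have "\<dots> = (\<Sum>l\<in>I. P (ket l) i * cnj (P (ket l) k))"
    by (intro sum.cong refl) (simp add: adj)
  finally show ?thesis .
qed

text \<open>
  Since \<open>P = P\<^sup>2\<close>, the operator \<open>Tr\<^sub>A[(P \<otimes> 1) \<rho>]\<close> is \<open>Tr\<^sub>A[(P \<otimes> 1) \<rho> (P \<otimes> 1)]\<close>, which makes its
  positivity visible.
\<close>

lemma steered_quadratic_form:
  assumes I: "finite I" and J: "finite J" and P: "orth_projector I P"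
    and \<rho>: "bounded_operator (I \<times> J) \<rho>" and \<psi>: "\<psi> \<in> l2 J"
  defines "\<phi> \<equiv> \<lambda>m (i, j). P (ket m) i * \<psi> j"
  shows "l2_inner J \<psi> (matrix_op J (\<lambda>l j. c * steered_matrix I P \<rho> l j) \<psi>) =
    c * (\<Sum>m\<in>I. l2_inner (I \<times> J) (\<phi> m) (\<rho> (\<phi> m)))"
proof -
  have b: "bounded_operator I P" using P by (simp add: orth_projector_def)
  have entry: "(\<Sum>m\<in>I. P (ket m) i * cnj (P (ket m) k)) = P (ket k) i" if "i \<in> I" "k \<in> I" for i k
    using orth_projector_entry[OF I P that] by (rule sym)
  let ?r = "\<lambda>k l i j. \<rho> (ket (i, j)) (k, l)"
  have \<phi>: "\<phi> m \<in> l2 (I \<times> J)" if "m \<in> I" for m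
    using bounded_operator_outside[OF I b ket_in_l2[OF I that]] \<psi> I J
    by (auto simp: l2_finite \<phi>_def)
  \<comment> \<open>The vector \<open>\<phi> m\<close> is the product of \<open>P (ket m)\<close>
    and \<open>\<psi>\<close>. In \<open>?u\<close> the index \<open>m\<close> occurs only in the
    first two factors, so once its sum is moved innermost, \<open>entry\<close> collapses it to
    \<open>P (ket k) i\<close>.\<close>
  let ?u = "\<lambda>m k l i j. P (ket m) i * cnj (P (ket m) k) * (cnj (\<psi> l) * (?r k l i j * \<psi> j))"
  have "l2_inner (I \<times> J) (\<phi> m) (\<rho> (\<phi> m)) = (\<Sum>k\<in>I. \<Sum>l\<in>J. \<Sum>i\<in>I. \<Sum>j\<in>J. ?u m k l i j)"
    if "m \<in> I" for m
  proof -
    have r: "\<rho> (\<phi> m) p = (\<Sum>i\<in>I. \<Sum>j\<in>J. \<rho> (ket (i, j)) p * \<phi> m (i, j))" for p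
      using bounded_operator_matrix[OF _ \<rho> \<phi>[OF that], of p] I J
      by (simp add: sum.cartesian_product case_prod_unfold)
    have "l2_inner (I \<times> J) (\<phi> m) (\<rho> (\<phi> m)) =
        (\<Sum>k\<in>I. \<Sum>l\<in>J. cnj (\<phi> m (k, l)) * \<rho> (\<phi> m) (k, l))"
      using I J by (simp add: l2_inner_finite sum.cartesian_product case_prod_unfold)
    then show ?thesis
      by (simp add: r sum_distrib_left) (simp add: \<phi>_def mult_ac)
  qed
  then have "(\<Sum>m\<in>I. l2_inner (I \<times> J) (\<phi> m) (\<rho> (\<phi> m))) =
      (\<Sum>m\<in>I. \<Sum>k\<in>I. \<Sum>l\<in>J. \<Sum>i\<in>I. \<Sum>j\<in>J. ?u m k l i j)"
    by simp
  also have "\<dots> = (\<Sum>k\<in>I. \<Sum>m\<in>I. \<Sum>l\<in>J. \<Sum>i\<in>I. \<Sum>j\<in>J. ?u m k l i j)"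
    by (rule sum.swap)
  also have "\<dots> = (\<Sum>k\<in>I. \<Sum>l\<in>J. \<Sum>m\<in>I. \<Sum>i\<in>I. \<Sum>j\<in>J. ?u m k l i j)"
    by (intro sum.cong refl sum.swap)
  also have "\<dots> = (\<Sum>k\<in>I. \<Sum>l\<in>J. \<Sum>i\<in>I. \<Sum>m\<in>I. \<Sum>j\<in>J. ?u m k l i j)"
    by (intro sum.cong refl sum.swap)
  also have "\<dots> = (\<Sum>k\<in>I. \<Sum>l\<in>J. \<Sum>i\<in>I. \<Sum>j\<in>J. \<Sum>m\<in>I. ?u m k l i j)"
    by (intro sum.cong refl sum.swap)
  also have "\<dots> = (\<Sum>k\<in>I. \<Sum>l\<in>J. \<Sum>i\<in>I. \<Sum>j\<in>J. P (ket k) i * (cnj (\<psi> l) * (?r k l i j * \<psi> j)))"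
    by (intro sum.cong refl) (simp add: entry flip: sum_distrib_right)
  \<comment> \<open>The remaining swaps reach the order \<open>l\<close>, \<open>j\<close>,
    \<open>i\<close>, \<open>k\<close> in which \<open>matrix_op\<close> and
    \<open>steered_matrix\<close> unfold.\<close>
  also have "\<dots> = (\<Sum>l\<in>J. \<Sum>k\<in>I. \<Sum>i\<in>I. \<Sum>j\<in>J. P (ket k) i * (cnj (\<psi> l) * (?r k l i j * \<psi> j)))"
    by (rule sum.swap)
  also have "\<dots> = (\<Sum>l\<in>J. \<Sum>k\<in>I. \<Sum>j\<in>J. \<Sum>i\<in>I. P (ket k) i * (cnj (\<psi> l) * (?r k l i j * \<psi> j)))"
    by (intro sum.cong refl sum.swap)
  also have "\<dots> = (\<Sum>l\<in>J. \<Sum>j\<in>J. \<Sum>k\<in>I. \<Sum>i\<in>I. P (ket k) i * (cnj (\<psi> l) * (?r k l i j * \<psi> j)))"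
    by (intro sum.cong refl sum.swap)
  also have "\<dots> = (\<Sum>l\<in>J. \<Sum>j\<in>J. \<Sum>i\<in>I. \<Sum>k\<in>I. P (ket k) i * (cnj (\<psi> l) * (?r k l i j * \<psi> j)))"
    by (intro sum.cong refl sum.swap)
  finally show ?thesis
    by (simp add: l2_inner_finite J matrix_op_def steered_matrix_def sum_distrib_left
        sum_distrib_right mult_ac)
qed

text \<open>By \<open>tr\<close>, \<open>c\<close> is the inverse of the outcome probability.
  Positivity holds because each quadratic form is \<open>c\<close> times a sum of quadratic forms of
  \<open>\<rho>\<close>.\<close>

lemma density_operator_steered:
  assumes I: "finite I" and J: "finite J" and P: "orth_projector I P"
    and \<rho>: "density_operator (I \<times> J) \<rho>" and "0 \<le> c"
    and tr: "complex_of_real c * op_trace (I \<times> J) (tensor_op P id \<circ> \<rho>) = 1"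
  shows "density_operator J (matrix_op J (\<lambda>l j. c * steered_matrix I P \<rho> l j))"
  unfolding density_operator_def
proof (intro conjI ballI)
  have b: "bounded_operator I P" using P by (simp add: orth_projector_def)
  have b\<rho>: "bounded_operator (I \<times> J) \<rho>" using \<rho> by (simp add: density_operator_def)
  let ?\<sigma> = "matrix_op J (\<lambda>l j. c * steered_matrix I P \<rho> l j)"
  show "bounded_operator J ?\<sigma>" by (rule bounded_operator_matrix_op[OF J])
  show "op_trace J ?\<sigma> = 1"
    using op_trace_steered[OF I J b bounded_operator_id b\<rho>, of c] tr by (simp add: comp_def)
  fix \<psi> assume \<psi>: "\<psi> \<in> l2 J"
  let ?\<phi> = "\<lambda>m (i, j). P (ket m) i * \<psi> j"
  have "?\<phi> m \<in> l2 (I \<times> J)" if "m \<in> I" for m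
    using bounded_operator_outside[OF I b ket_in_l2[OF I that]] \<psi> I J by (auto simp: l2_finite)
  then have "Im (l2_inner (I \<times> J) (?\<phi> m) (\<rho> (?\<phi> m))) = 0"
    "0 \<le> Re (l2_inner (I \<times> J) (?\<phi> m) (\<rho> (?\<phi> m)))" if "m \<in> I" for m
    using \<rho> that unfolding density_operator_def by blast+
  then show "Im (l2_inner J \<psi> (?\<sigma> \<psi>)) = 0" "0 \<le> Re (l2_inner J \<psi> (?\<sigma> \<psi>))"
    unfolding steered_quadratic_form[OF I J P b\<rho> \<psi>] using \<open>0 \<le> c\<close>
    by (auto simp: sum_nonneg)
qed

section \<open>Payoffs\<close>

text \<open>The term \<open>(d - x0) mod d\<close> represents \<open>-x0\<close>. Adding
  \<open>x0\<close> to both sides of the congruence leaves exactly one residue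
  \<open>b\<close>.\<close>

lemma sum_mod_eq_delta:
  fixes f :: "nat \<Rightarrow> real"
  assumes "x0 < d"
  shows "(\<Sum>b<d. if ((d - x0) mod d + b) mod d = s mod d then f b else 0) = f ((x0 + s) mod d)"
proof -
  have "((d - x0) mod d + b) mod d = s mod d \<longleftrightarrow> b = (x0 + s) mod d" if "b < d" for b
  proof
    assume "((d - x0) mod d + b) mod d = s mod d"
    then have "(x0 + (d - x0 + b)) mod d = (x0 + s) mod d"
      by (metis mod_add_left_eq mod_add_right_eq)
    then show "b = (x0 + s) mod d" using assms that by simp
  next
    assume "b = (x0 + s) mod d"
    then have "((d - x0) mod d + b) mod d = (d - x0 + (x0 + s)) mod d"
      by (metis mod_add_eq mod_mod_trivial)
    then show "((d - x0) mod d + b) mod d = s mod d" using assms by simp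
  qed
  then have "(\<Sum>b<d. if ((d - x0) mod d + b) mod d = s mod d then f b else 0) =
      (\<Sum>b<d. if b = (x0 + s) mod d then f b else 0)"
    by (intro sum.cong) auto
  then show ?thesis using assms by simp
qed

text \<open>Negation modulo \<open>d\<close> is an involution of the residues; the outer
  \<open>mod\<close> sends \<open>d - 0\<close> to 0.\<close>

lemma sum_neg_mod:
  fixes f :: "nat \<Rightarrow> real"
  shows "(\<Sum>x0<d. f ((d - x0) mod d)) = (\<Sum>a<d. f a)"
proof -
  have "(d - (d - x) mod d) mod d = x" if "x < d" for x
    using that by (cases "x = 0") auto
  then show ?thesis
    by (intro sum.reindex_bij_witness[where i = "\<lambda>x. (d - x) mod d" and j = "\<lambda>x. (d - x) mod d"]) auto
qed

lemma linear_strategy_eq_prob_sum_eq: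
  "linear_strategy d P x0 x y ((x0 + s) mod d) = prob_sum_eq d P x y s"
proof -
  have "((x0 + a) mod d + b) mod d = (x0 + s) mod d \<longleftrightarrow> (a + b) mod d = s mod d" for a b
  proof -
    have "((x0 + a) mod d + b) mod d = (x0 + (a + b)) mod d"
      by (metis add.assoc mod_add_left_eq)
    \<comment> \<open>\<open>nat_mod_eq_iff\<close> turns both congruences into equations up to
      multiples of \<open>d\<close>, in which \<open>x0\<close> cancels.\<close>
    then show ?thesis by (simp add: nat_mod_eq_iff[of "x0 + (a + b)"] nat_mod_eq_iff[of "a + b"] add.assoc)
  qed
  then show ?thesis by (simp add: linear_strategy_def prob_sum_eq_def Let_def)
qed

text \<open>As \<open>x0\<close> varies, \<open>-x0\<close> runs once through Alice's outcomes, and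
  \<open>x0 + s\<close> is the only matching outcome of Bob.\<close>

lemma prob_sum_eq_sum_shift:
  "(\<Sum>x0<d. P ((d - x0) mod d) ((x0 + s) mod d) x y) = prob_sum_eq d P x y s"
proof -
  have "(\<Sum>x0<d. P ((d - x0) mod d) ((x0 + s) mod d) x y) =
      (\<Sum>x0<d. \<Sum>b<d. if ((d - x0) mod d + b) mod d = s mod d then P ((d - x0) mod d) b x y else 0)"
    by (intro sum.cong refl sum_mod_eq_delta[symmetric]) simp
  also have "\<dots> = prob_sum_eq d P x y s"
    unfolding prob_sum_eq_def by (rule sum_neg_mod)
  finally show ?thesis .
qed

text \<open>Since \<open>x0\<close> is uniform, only sums over \<open>x0\<close> matter. The two
  strategies compared below need not agree for a single \<open>x0\<close>.\<close>

lemma average_payoff_cong_sum: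
  assumes "\<And>x y i k. x < setsA \<B> \<Longrightarrow> y < setsB \<B> \<Longrightarrow>
    (\<Sum>x0<outs \<B>. R x0 x y ((x0 + shiftF \<B> x y i k) mod outs \<B>)) =
    (\<Sum>x0<outs \<B>. R' x0 x y ((x0 + shiftF \<B> x y i k) mod outs \<B>))"
  shows "average_payoff \<B> R = average_payoff \<B> R'"
proof -
  have "average_payoff \<B> R = 1 / real (outs \<B>) *
     (\<Sum>x<setsA \<B>. \<Sum>y<setsB \<B>. input_prob \<B> x y *
        (\<Sum>k=0..topK \<B>. \<Sum>i=1..numF \<B>. coef \<B> x y i k *
           (\<Sum>x0<outs \<B>. R x0 x y ((x0 + shiftF \<B> x y i k) mod outs \<B>))))" for R
  proof -
    let ?t = "\<lambda>x0 x y k i. input_prob \<B> x y *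
      (coef \<B> x y i k * R x0 x y ((x0 + shiftF \<B> x y i k) mod outs \<B>))"
    have "(\<Sum>x0<outs \<B>. \<Sum>x<setsA \<B>. \<Sum>y<setsB \<B>. \<Sum>k=0..topK \<B>. \<Sum>i=1..numF \<B>. ?t x0 x y k i) =
        (\<Sum>x<setsA \<B>. \<Sum>x0<outs \<B>. \<Sum>y<setsB \<B>. \<Sum>k=0..topK \<B>. \<Sum>i=1..numF \<B>. ?t x0 x y k i)"
      by (rule sum.swap)
    also have "\<dots> = (\<Sum>x<setsA \<B>. \<Sum>y<setsB \<B>. \<Sum>x0<outs \<B>. \<Sum>k=0..topK \<B>. \<Sum>i=1..numF \<B>. ?t x0 x y k i)"
      by (intro sum.cong refl sum.swap)
    also have "\<dots> = (\<Sum>x<setsA \<B>. \<Sum>y<setsB \<B>. \<Sum>k=0..topK \<B>. \<Sum>x0<outs \<B>. \<Sum>i=1..numF \<B>. ?t x0 x y k i)"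
      by (intro sum.cong refl sum.swap)
    also have "\<dots> = (\<Sum>x<setsA \<B>. \<Sum>y<setsB \<B>. \<Sum>k=0..topK \<B>. \<Sum>i=1..numF \<B>. \<Sum>x0<outs \<B>. ?t x0 x y k i)"
      by (intro sum.cong refl sum.swap)
    finally show ?thesis
      by (simp add: average_payoff_def sum_distrib_left)
  qed
  then show ?thesis using assms by simp
qed

section \<open>The protocol of steered states and its payoff\<close>

theorem theorem3:
  fixes \<B> :: bell and D :: nat and \<rho> :: "(nat \<times> nat) operator"
    and PA QB :: "nat \<Rightarrow> nat \<Rightarrow> nat operator"
  assumes "bell_inequality \<B>"
    and "outs \<B> \<le> D"
    and "quantum_model \<B> {..<D} {..<outs \<B>} \<rho> PA QB"
    and "bell_value \<B> (quantum_corr {..<D} {..<outs \<B>} \<rho> PA QB) > classical_bound \<B>"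
    and "ereal (bell_value \<B> (quantum_corr {..<D} {..<outs \<B>} \<rho> PA QB)) = max_quantum_value \<B>"
    and "\<forall>x<setsA \<B>. \<forall>a<outs \<B>.
           op_trace ({..<D} \<times> {..<outs \<B>}) (tensor_op (PA x a) id \<circ> \<rho>) = 1 / of_nat (outs \<B>)"
  shows "\<exists>\<sigma> M. ptm_protocol \<B> \<sigma> M \<and>
           qc_payoff \<B> \<sigma> M = cc_payoff \<B> (quantum_corr {..<D} {..<outs \<B>} \<rho> PA QB)"
proof -
  let ?d = "outs \<B>" and ?I = "{..<D}" and ?J = "{..<outs \<B>}"
  let ?P = "quantum_corr ?I ?J \<rho> PA QB"
  \<comment> \<open>The factor \<open>real ?d\<close> inverts the outcome probability
    \<open>1/d\<close>; the outer \<open>mod\<close> makes \<open>-x0\<close> a valid outcome also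
    for \<open>x0 = 0\<close>.\<close>
  define \<sigma> where "\<sigma> = (\<lambda>x0 x.
    matrix_op ?J (\<lambda>l j. of_real (real ?d) * steered_matrix ?I (PA x ((?d - x0) mod ?d)) \<rho> l j))"
  have d: "0 < ?d" using assms(1) by (simp add: bell_inequality_def)
  have \<rho>: "density_operator (?I \<times> ?J) \<rho>"
    and QB: "\<And>y. y < setsB \<B> \<Longrightarrow> projective_measurement ?d ?J (QB y)"
    and PA: "\<And>x a. x < setsA \<B> \<Longrightarrow> a < ?d \<Longrightarrow> orth_projector ?I (PA x a)"
    using assms(3) by (auto simp: quantum_model_def projective_measurement_def)
  have "density_operator ?J (\<sigma> x0 x)" if "x < setsA \<B>" for x0 x
    unfolding \<sigma>_def using assms(6) that d
    by (intro density_operator_steered PA \<rho>) auto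
  then have "ptm_protocol \<B> \<sigma> QB"
    using QB by (simp add: ptm_protocol_def)
  moreover have "qc_payoff \<B> \<sigma> QB = cc_payoff \<B> ?P"
    unfolding qc_payoff_def cc_payoff_def
  proof (rule average_payoff_cong_sum)
    fix x y i k assume xy: "x < setsA \<B>" "y < setsB \<B>"
    let ?s = "shiftF \<B> x y i k"
    \<comment> \<open>The right-hand side is Bob's conditional probability of \<open>b\<close> given
      Alice's outcome \<open>-x0\<close>.\<close>
    have steer: "Re (op_trace ?J (QB y b \<circ> \<sigma> x0 x)) = real ?d * ?P ((?d - x0) mod ?d) b x y"
      if "b < ?d" for b x0
    proof -
      have A: "bounded_operator ?I (PA x ((?d - x0) mod ?d))"
        using PA[OF xy(1)] d by (simp add: orth_projector_def)
      have B: "bounded_operator ?J (QB y b)"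
        using QB[OF xy(2)] that by (simp add: projective_measurement_def orth_projector_def)
      have "bounded_operator (?I \<times> ?J) \<rho>"
        using \<rho> by (simp add: density_operator_def)
      from op_trace_steered[OF _ _ A B this] show ?thesis
        by (simp add: \<sigma>_def quantum_corr_def)
    qed
    have "(\<Sum>x0<?d. Re (op_trace ?J (QB y ((x0 + ?s) mod ?d) \<circ> \<sigma> x0 x))) =
        real ?d * (\<Sum>x0<?d. ?P ((?d - x0) mod ?d) ((x0 + ?s) mod ?d) x y)"
      using d by (simp add: steer sum_distrib_left)
    \<comment> \<open>Both sides are \<open>real ?d\<close> times \<open>prob_sum_eq\<close>: on the
      left the sum over \<open>x0\<close> collects its terms, on the right each of the
      \<open>?d\<close> summands already equals it.\<close>
    also have "\<dots> = (\<Sum>x0<?d. linear_strategy ?d ?P x0 x y ((x0 + ?s) mod ?d))"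
      by (simp add: prob_sum_eq_sum_shift linear_strategy_eq_prob_sum_eq)
    finally show "(\<Sum>x0<?d. Re (op_trace ?J (QB y ((x0 + ?s) mod ?d) \<circ> \<sigma> x0 x))) = \<dots>" .
  qed
  ultimately show ?thesis by blast
qed

end
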